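(* For $j=1,\ldots,N$ and all $s\in\mathbb{C}$ with $\mathrm{Re}(s)\ge 0$ and $s\notin\{\lambda_1,\ldots,\lambda_N\}$, $$Z_j(s)=\frac{\lambda_j}{\lambda_j-s}\sum_{i=1}^N p_{i,j}\,\beta_i^*(s)\,Z_i(as)-\frac{s}{\lambda_j-s}\,v_j ,\qquad v_j:=\sum_{i=1}^N p_{i,j}\,\beta_i^*(\lambda_j)\,Z_i(a\lambda_j).$$ Equivalently, the vector $\tilde Z(s)=(Z_1(s),\ldots,Z_N(s))^T$ satisfies $$\tilde Z(s)=H(s)\tilde Z(as)+\tilde V(s),$$ where $H(s)=L(s)P^TB^*(s)$, $\tilde V(s)=sF(s)\tilde v$, $F(s)=-\Lambda^{-1}L(s)$ and $\tilde v=(v_1,\ldots,v_N)^T$.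
   Context: Let $E=\{1,\ldots,N\}$, $a\in(0,1)$. $(Y_n)_{n\ge0}$ is an irreducible discrete-time Markov chain on $E$ with transition matrix $P=(p_{i,j})$ and stationary distribution $\tilde\pi=(\pi_1,\ldots,\pi_N)^T$. The nonnegative process $W_n$ (workload just before the $n$th arrival) satisfies $W_{n+1}=[aW_n+S_n-A_{n+1}]^+$, where $[x]^+=\max(0,x)$ and $S_n,A_{n+1}\ge0$. Given $Y_n$, the triple $(A_{n+1},S_n,Y_{n+1})$ is independent of the past (in particular of $W_n$), and for $x,y\ge0$ $$P(A_{n+1}\le x,S_n\le y,Y_{n+1}=j\mid Y_n=i)=p_{i,j}F_{S,i}(y)G_{A,j}(x),$$ where $F_{S,i}$ is a distribution function on $[0,\infty)$ and $G_{A,j}(x)=1-e^{-\lambda_jx}$ with $\lambda_j>0$. Notation: $\beta_i^*(s)=\int_0^\infty e^{-st}dF_{S,i}(t)$, $B^*(s)=\mathrm{diag}(\beta_1^*(s),\ldots,\beta_N^*(s))$, $\Lambda=\mathrm{diag}(\lambda_1,\ldots,\lambda_N)$, $L(s)=\mathrm{diag}\big(\frac{\lambda_1}{\lambda_1-s},\ldots,\frac{\lambda_N}{\lambda_N-s}\big)$. For $\mathrm{Re}(s)\ge0$, $Z_i^n(s)=E(e^{-sW_n}1_{\{Y_n=i\}})$ and $Z_i(s)=\lim_{n\to\infty}Z_i^n(s)$; it is assumed that these limits exist and are the transforms $E(e^{-sW}1_{\{Y=i\}})$ of a steady-state pair $(W,Y)$ with $W$ finite and $P(Y=i)=\pi_i$.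 *)

theory Defs
  imports "HOL-Probability.Probability"
begin

definition diag_mat :: "('n \<Rightarrow> 'a::zero) \<Rightarrow> 'a^'n^'n" where
  "diag_mat d = (\<chi> i j. if i = j then d i else 0)"

(* The power operation of the type class instance on 'a^'n^'n is componentwise. *)
definition mat_power :: "('a::semiring_1)^'n^'n \<Rightarrow> nat \<Rightarrow> 'a^'n^'n" where
  "mat_power P n = ((\<lambda>X. X ** P) ^^ n) (mat 1)"

definition stochastic_matrix :: "real^'n^'n \<Rightarrow> bool" where
  "stochastic_matrix P \<longleftrightarrow> (\<forall>i j. 0 \<le> P $ i $ j) \<and> (\<forall>i. (\<Sum>j\<in>UNIV. P $ i $ j) = 1)"

definition irreducible_matrix :: "real^'n^'n \<Rightarrow> bool" where
  "irreducible_matrix P \<longleftrightarrow> (\<forall>i j. \<exists>n. 0 < mat_power P n $ i $ j)"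

definition stationary_distribution :: "real^'n^'n \<Rightarrow> real^'n \<Rightarrow> bool" where
  "stationary_distribution P \<pi> \<longleftrightarrow>
     (\<forall>i. 0 \<le> \<pi> $ i) \<and> (\<Sum>i\<in>UNIV. \<pi> $ i) = 1 \<and> transpose P *v \<pi> = \<pi>"

definition markov_chain :: "'w measure \<Rightarrow> (nat \<Rightarrow> 'w \<Rightarrow> 'n::finite) \<Rightarrow> real^'n^'n \<Rightarrow> bool" where
  "markov_chain M Y P \<longleftrightarrow>
     stochastic_matrix P \<and>
     (\<forall>n. Y n \<in> measurable M (count_space UNIV)) \<and>
     (\<forall>n c j. \<P>(\<omega> in M. \<forall>k\<le>n. Y k \<omega> = c k) > 0 \<longrightarrow>
        \<P>(\<omega> in M. Y (Suc n) \<omega> = j \<bar> \<forall>k\<le>n. Y k \<omega> = c k) = P $ c n $ j)"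

definition distribution_function_nonneg :: "(real \<Rightarrow> real) \<Rightarrow> bool" where
  "distribution_function_nonneg F \<longleftrightarrow>
     mono F \<and> (\<forall>x. continuous (at_right x) F) \<and> (\<forall>x<0. F x = 0) \<and> (F \<longlongrightarrow> 1) at_top"

(* Just before the n-th arrival: W_0, ..., W_n and Y_0, ..., Y_n, the
   interarrival times A_1, ..., A_n and the service times S_0, ..., S_{n-1}. *)
definition past ::
  "'w measure \<Rightarrow> (nat \<Rightarrow> 'w \<Rightarrow> real) \<Rightarrow> (nat \<Rightarrow> 'w \<Rightarrow> real) \<Rightarrow> (nat \<Rightarrow> 'w \<Rightarrow> real) \<Rightarrow>
   (nat \<Rightarrow> 'w \<Rightarrow> 'n) \<Rightarrow> nat \<Rightarrow> 'w set set" where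
  "past M W A S Y n = sigma_sets (space M)
     ({W k -` B \<inter> space M | k B. k \<le> n \<and> B \<in> sets borel} \<union>
      {Y k -` B \<inter> space M | k B. k \<le> n} \<union>
      {A k -` B \<inter> space M | k B. 1 \<le> k \<and> k \<le> n \<and> B \<in> sets borel} \<union>
      {S k -` B \<inter> space M | k B. k < n \<and> B \<in> sets borel})"

definition current_triple ::
  "'w measure \<Rightarrow> (nat \<Rightarrow> 'w \<Rightarrow> real) \<Rightarrow> (nat \<Rightarrow> 'w \<Rightarrow> real) \<Rightarrow>
   (nat \<Rightarrow> 'w \<Rightarrow> 'n) \<Rightarrow> nat \<Rightarrow> 'w set set" where
  "current_triple M A S Y n =
     sets (vimage_algebra (space M) (\<lambda>\<omega>. (A (Suc n) \<omega>, S n \<omega>, Y (Suc n) \<omega>))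
       (borel \<Otimes>\<^sub>M (borel \<Otimes>\<^sub>M count_space UNIV)))"

(* Conditional independence given a discrete variable: independence under each
   elementary conditional measure P(. | X = i). *)
definition cond_indep_given ::
  "'w measure \<Rightarrow> ('w \<Rightarrow> 'n) \<Rightarrow> 'w set set \<Rightarrow> 'w set set \<Rightarrow> bool" where
  "cond_indep_given M X \<A> \<B> \<longleftrightarrow>
     (\<forall>i. \<P>(\<omega> in M. X \<omega> = i) > 0 \<longrightarrow>
        prob_space.indep_set (uniform_measure M {\<omega> \<in> space M. X \<omega> = i}) \<A> \<B>)"

(* The range {0..} contains 0, so an atom of F at 0 contributes. *)
definition LS_transform :: "(real \<Rightarrow> real) \<Rightarrow> complex \<Rightarrow> complex" where
  "LS_transform F s = (LINT t:{0..}|interval_measure F. exp (- s * complex_of_real t))"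

definition joint_transform ::
  "'w measure \<Rightarrow> ('w \<Rightarrow> real) \<Rightarrow> ('w \<Rightarrow> 'n) \<Rightarrow> 'n \<Rightarrow> complex \<Rightarrow> complex" where
  "joint_transform M X U i s =
     (LINT \<omega>|M. exp (- s * complex_of_real (X \<omega>)) * indicator {\<omega>. U \<omega> = i} \<omega>)"

definition Z_lim ::
  "'w measure \<Rightarrow> (nat \<Rightarrow> 'w \<Rightarrow> real) \<Rightarrow> (nat \<Rightarrow> 'w \<Rightarrow> 'n) \<Rightarrow> 'n \<Rightarrow> complex \<Rightarrow> complex" where
  "Z_lim M W Y i s = lim (\<lambda>n. joint_transform M (W n) (Y n) i s)"

definition Lambda_mat :: "('n \<Rightarrow> real) \<Rightarrow> complex^'n^'n" where
  "Lambda_mat lam = diag_mat (\<lambda>j. complex_of_real (lam j))"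

definition L_mat :: "('n \<Rightarrow> real) \<Rightarrow> complex \<Rightarrow> complex^'n^'n" where
  "L_mat lam s = diag_mat (\<lambda>j. complex_of_real (lam j) / (complex_of_real (lam j) - s))"

definition B_mat :: "('n \<Rightarrow> real \<Rightarrow> real) \<Rightarrow> complex \<Rightarrow> complex^'n^'n" where
  "B_mat FS s = diag_mat (\<lambda>i. LS_transform (FS i) s)"

definition H_mat ::
  "real^'n^'n \<Rightarrow> ('n \<Rightarrow> real \<Rightarrow> real) \<Rightarrow> ('n \<Rightarrow> real) \<Rightarrow> complex \<Rightarrow> complex^'n^'n" where
  "H_mat P FS lam s = L_mat lam s ** transpose (map_matrix complex_of_real P) ** B_mat FS s"

definition F_mat :: "('n \<Rightarrow> real) \<Rightarrow> complex \<Rightarrow> complex^'n^'n" where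
  "F_mat lam s = - (matrix_inv (Lambda_mat lam) ** L_mat lam s)"

definition Z_vec ::
  "'w measure \<Rightarrow> (nat \<Rightarrow> 'w \<Rightarrow> real) \<Rightarrow> (nat \<Rightarrow> 'w \<Rightarrow> 'n) \<Rightarrow> complex \<Rightarrow> complex^'n" where
  "Z_vec M W Y s = (\<chi> j. Z_lim M W Y j s)"

definition v_vec ::
  "'w measure \<Rightarrow> (nat \<Rightarrow> 'w \<Rightarrow> real) \<Rightarrow> (nat \<Rightarrow> 'w \<Rightarrow> 'n) \<Rightarrow>
   real^'n^'n \<Rightarrow> ('n \<Rightarrow> real \<Rightarrow> real) \<Rightarrow> ('n \<Rightarrow> real) \<Rightarrow> real \<Rightarrow> complex^'n" where
  "v_vec M W Y P FS lam a =
     (\<chi> j. \<Sum>i\<in>UNIV. complex_of_real (P $ i $ j) *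
        LS_transform (FS i) (complex_of_real (lam j)) *
        Z_lim M W Y i (complex_of_real a * complex_of_real (lam j)))"

definition V_vec ::
  "'w measure \<Rightarrow> (nat \<Rightarrow> 'w \<Rightarrow> real) \<Rightarrow> (nat \<Rightarrow> 'w \<Rightarrow> 'n) \<Rightarrow>
   real^'n^'n \<Rightarrow> ('n \<Rightarrow> real \<Rightarrow> real) \<Rightarrow> ('n \<Rightarrow> real) \<Rightarrow> real \<Rightarrow> complex \<Rightarrow> complex^'n" where
  "V_vec M W Y P FS lam a s = s *s (F_mat lam s *v v_vec M W Y P FS lam a)"

end

theory Submission
  imports Defs
begin

text \<open>
  The functional equation is the limit of an exact one-step identity. Given \<open>Y n = i\<close>, the workload
  \<open>W n\<close> is independent of \<open>(A (Suc n), S n, Y (Suc n))\<close>, and on \<open>Y (Suc n) = j\<close> the service and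
  interarrival times have, up to the total mass \<open>P $ i $ j\<close>, the product law of \<open>FS i\<close> and the exponential
  distribution with rate \<open>lam j\<close>. So one may integrate over the interarrival time first, with
  \<open>u = a * W n + S n \<ge> 0\<close> held constant. Splitting the exponential variable at \<open>u\<close> gives
  \<open>E (exp (- s * max 0 (u - A))) = (lam j * exp (- s * u) - s * exp (- lam j * u)) / (lam j - s)\<close>
  (\<open>integral_exponential_reflected\<close>). This is the point of the exponential assumption: reflection at 0
  turns into a combination of just two exponentials of \<open>u\<close>, with exponents \<open>s\<close> and \<open>lam j\<close>. Each of them
  factorises over the independent summands \<open>a * W n\<close> and \<open>S n\<close>; the first gives the term with
  \<open>LS_transform (FS i) s\<close> and the transform of \<open>W n\<close> at \<open>a * s\<close>, the second gives the same expression at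
  \<open>lam j\<close>, that is, the constant \<open>v_vec\<close>. Summation over \<open>i\<close> is \<open>joint_transform_step\<close>.

  Letting \<open>n\<close> tend to infinity is immediate, since the transforms converge at each of the points \<open>s\<close>,
  \<open>a * s\<close> and \<open>a * lam j\<close> of the closed right half-plane. The matrix form is the same identity read
  componentwise, because all matrices other than \<open>P\<close> are diagonal.

  The measure-theoretic work lies in \<open>distr_joint\<close>: the hypotheses only give probabilities of quadrants and
  products of conditional probabilities, whereas Fubini's theorem needs equality with a product measure.
\<close>

section \<open>Product measures, distribution functions and transforms\<close>

text \<open>
  The closed lower-left quadrants are the sets \<open>{..z}\<close> of the product order on the plane, and hence an
  intersection-stable generator of the Borel sets. The factor \<open>c\<close> permits measures that are not
  probabilities, so that an event of probability 0 needs no normalisation.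
\<close>
lemma emeasure_eq_pair_measure_atMost:
  fixes K :: "(real \<times> real) measure"
  assumes "prob_space \<mu>" and "prob_space \<nu>"
    and sets: "sets K = sets borel" "sets \<mu> = sets borel" "sets \<nu> = sets borel"
    and c: "c < \<infinity>"
    and quadrants: "\<And>y x. emeasure K ({..y} \<times> {..x}) = c * (emeasure \<mu> {..y} * emeasure \<nu> {..x})"
    and C: "C \<in> sets borel"
  shows "emeasure K C = c * emeasure (\<mu> \<Otimes>\<^sub>M \<nu>) C"
proof -
  interpret \<mu>: prob_space \<mu> by fact
  interpret \<nu>: prob_space \<nu> by fact
  interpret pair_prob_space \<mu> \<nu> ..
  have sets_pair: "sets (\<mu> \<Otimes>\<^sub>M \<nu>) = sets (borel :: (real \<times> real) measure)"
    using sets_pair_measure_cong[OF sets(2,3)] unfolding borel_prod .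
  have atMost_Times: "{..z :: real \<times> real} = {..fst z} \<times> {..snd z}" for z
    by (auto simp: less_eq_prod_def)
  have "K = scale_measure c (\<mu> \<Otimes>\<^sub>M \<nu>)"
  proof (rule measure_eqI_generator_eq)
    show "Int_stable (range (\<lambda>z :: real \<times> real. {..z}))"
    proof (rule Int_stableI_image)
      fix z z' :: "real \<times> real"
      have "{..z} \<inter> {..z'} = {..inf z z'}" by auto
      then show "\<exists>w\<in>UNIV. {..z} \<inter> {..z'} = {..w}" by blast
    qed
    show "sets K = sigma_sets UNIV (range (\<lambda>z :: real \<times> real. {..z}))"
      unfolding sets(1) by (subst borel_eq_atMost) (simp add: sets_measure_of)
    show "sets (scale_measure c (\<mu> \<Otimes>\<^sub>M \<nu>)) = sigma_sets UNIV (range (\<lambda>z :: real \<times> real. {..z}))"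
      unfolding sets_scale_measure sets_pair by (subst borel_eq_atMost) (simp add: sets_measure_of)
    show eq: "emeasure K B = emeasure (scale_measure c (\<mu> \<Otimes>\<^sub>M \<nu>)) B"
      if "B \<in> range (\<lambda>z :: real \<times> real. {..z})" for B
      using that by (auto simp: atMost_Times quadrants sets \<nu>.emeasure_pair_measure_Times)
    show "(\<Union>n. {..(real n, real n)}) = (UNIV :: (real \<times> real) set)"
    proof -
      have "\<exists>n. z \<le> (real n, real n)" for z
        using real_arch_simple[of "max (fst z) (snd z)"] by (auto simp: less_eq_prod_def)
      then show ?thesis by auto
    qed
    show "emeasure K {..(real n, real n)} \<noteq> \<infinity>" for n
      using c \<mu>.emeasure_finite \<nu>.emeasure_finite
      by (simp add: atMost_Times quadrants ennreal_mult_eq_top_iff)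
  qed auto
  then show ?thesis by simp
qed

lemma distribution_function_nonneg_at_bot:
  assumes "distribution_function_nonneg F"
  shows "(F \<longlongrightarrow> 0) at_bot"
proof (rule tendsto_eventually)
  show "\<forall>\<^sub>F x in at_bot. F x = 0"
    using eventually_gt_at_bot eventually_at_bot_dense assms unfolding distribution_function_nonneg_def by blast
qed

lemma emeasure_interval_measure_atMost:
  assumes "distribution_function_nonneg F"
  shows "emeasure (interval_measure F) {..x} = F x"
  using assms distribution_function_nonneg_at_bot[OF assms]
  by (intro emeasure_interval_measure_Iic)
     (auto simp: distribution_function_nonneg_def mono_def)

lemma prob_space_interval_measure:
  assumes "distribution_function_nonneg F"
  shows "prob_space (interval_measure F)"
proof -
  have "real_distribution (interval_measure F)"
    using assms distribution_function_nonneg_at_bot[OF assms]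
    by (intro real_distribution_interval_measure)
       (auto simp: distribution_function_nonneg_def mono_def)
  then show ?thesis by (simp add: real_distribution_def)
qed

text \<open>
  The half-line of negative numbers is exhausted by the sets \<open>{..- 1 / Suc n}\<close>, on each of which the
  distribution function vanishes. Going up to 0 itself would fail if there is an atom at 0.
\<close>
lemma AE_interval_measure_nonneg:
  assumes F: "distribution_function_nonneg F"
  shows "AE x in interval_measure F. 0 \<le> x"
proof -
  have "emeasure (interval_measure F) {..<0} = 0"
  proof -
    have "emeasure (interval_measure F) (\<Union>n. {..- inverse (real (Suc n))}) = 0"
      using F by (intro emeasure_UN_eq_0)
        (auto simp: emeasure_interval_measure_atMost distribution_function_nonneg_def)
    also have "(\<Union>n. {..- inverse (real (Suc n))}) = {..<0}"
    proof (intro set_eqI iffI)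
      fix x :: real assume "x \<in> {..<0}"
      then obtain n where "inverse (real (Suc n)) < - x"
        using reals_Archimedean[of "- x"] by auto
      then show "x \<in> (\<Union>n. {..- inverse (real (Suc n))})"
        by (intro UN_I[of n]) auto
    next
      fix x :: real assume "x \<in> (\<Union>n. {..- inverse (real (Suc n))})"
      then obtain n where "x \<le> - inverse (real (Suc n))" by auto
      moreover have "0 < inverse (real (Suc n))" by simp
      ultimately show "x \<in> {..<0}" unfolding lessThan_iff by linarith
    qed
    finally show ?thesis .
  qed
  then show ?thesis
    by (intro AE_I[where N="{..<0}"]) auto
qed

lemma LS_transform_eq_integral:
  assumes F: "distribution_function_nonneg F"
  shows "LS_transform F z = (LINT t|interval_measure F. exp (- z * complex_of_real t))"
  unfolding LS_transform_def set_lebesgue_integral_def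
  using AE_interval_measure_nonneg[OF F]
  by (intro integral_cong_AE) (auto elim!: eventually_mono)

text \<open>
  The integrand is 1 on \<open>x > u\<close>, so it equals 1 plus a correction supported on the compact interval
  \<open>{0..u}\<close>. That correction is integrated by the fundamental theorem of calculus, and no integral over an
  unbounded interval is left.
\<close>
lemma integral_exponential_reflected:
  fixes z :: complex and l u :: real
  assumes l: "0 < l" and u: "0 \<le> u" and z: "0 \<le> Re z" "z \<noteq> complex_of_real l"
  shows "(LINT x|density lborel (exponential_density l). exp (- z * complex_of_real (max 0 (u - x))))
    = (of_real l * exp (- z * of_real u) - z * exp (- of_real l * of_real u)) / (of_real l - z)"
    (is "(LINT x|?E. _) = _")
proof -
  interpret E: prob_space ?E by (rule prob_space_exponential_density[OF l])
  define g :: "real \<Rightarrow> complex" where "g x = exp (- z * of_real (u - x)) - 1" for x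
  \<comment> \<open>On \<open>{0..u}\<close>, an antiderivative of the correction \<open>g\<close> times the exponential density.\<close>
  define G :: "real \<Rightarrow> complex" where
    "G x = of_real l / (z - of_real l) * exp (- z * of_real u) * exp ((z - of_real l) * of_real x)
      + exp (- of_real l * of_real x)" for x
  have zl: "z - of_real l \<noteq> 0" using z by simp
  have norm_g: "norm (g x) \<le> 2" if "x \<le> u" for x
  proof -
    have "norm (exp (- z * of_real (u - x))) \<le> 1" using z that by (simp add: norm_exp_eq_Re)
    then show ?thesis unfolding g_def by (smt (verit) norm_triangle_ineq4 norm_one)
  qed
  have "(LINT x|?E. exp (- z * complex_of_real (max 0 (u - x))))
      = (LINT x|?E. 1 + indicator {..u} x *\<^sub>R g x)"
    by (intro Bochner_Integration.integral_cong) (auto simp: g_def max_def indicator_def)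
  also have "\<dots> = (LINT x|?E. 1) + (LINT x|?E. indicator {..u} x *\<^sub>R g x)"
    using norm_g by (intro Bochner_Integration.integral_add E.integrable_const E.integrable_const_bound[where B=2])
      (auto simp: g_def indicator_def)
  also have "(LINT x|?E. (1::complex)) = 1"
    using E.prob_space by simp
  also have "(LINT x|?E. indicator {..u} x *\<^sub>R g x)
      = (LINT x|lborel. exponential_density l x *\<^sub>R (indicator {..u} x *\<^sub>R g x))"
    using l by (intro integral_density) (auto simp: g_def exponential_density_nonneg)
  also have "\<dots> = (LINT x|lborel. indicator {0..u} x *\<^sub>R (of_real l * exp (- of_real l * of_real x) * g x))"
  proof -
    have "complex_of_real (exp (- x * l)) = exp (- of_real l * of_real x)" for x
      by (simp add: exp_of_real[symmetric] mult.commute)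
    then show ?thesis
      by (intro Bochner_Integration.integral_cong)
         (auto simp: exponential_density_def indicator_def scaleR_conv_of_real)
  qed
  also have "\<dots> = G u - G 0"
  proof (rule integral_FTC_atLeastAtMost[OF u])
    have expand: "of_real l * exp (- of_real l * of_real x) * g x
        = of_real l / (z - of_real l) * exp (- z * of_real u) * (exp ((z - of_real l) * of_real x) * (z - of_real l))
          + exp (- of_real l * of_real x) * (- of_real l)" for x :: real
      using zl by (simp add: g_def algebra_simps mult_exp_exp[symmetric]  exp_diff exp_minus divide_simps)
    show "(G has_vector_derivative of_real l * exp (- of_real l * of_real x) * g x) (at x within {0..u})" for x
      unfolding expand G_def
      by (rule has_vector_derivative_real_field) (auto intro!: derivative_eq_intros)
    show "continuous_on {0..u} (\<lambda>x. of_real l * exp (- of_real l * of_real x) * g x)"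
      unfolding g_def by (intro continuous_intros)
  qed
  also have "G u = of_real l / (z - of_real l) * exp (- of_real l * of_real u) + exp (- of_real l * of_real u)"
    by (simp add: G_def mult.assoc mult_exp_exp) (simp add: algebra_simps)
  also have "G 0 = of_real l / (z - of_real l) * exp (- z * of_real u) + 1"
    by (simp add: G_def)
  finally have eq: "(LINT x|?E. exp (- z * complex_of_real (max 0 (u - x)))) =
      1 + (of_real l / (z - of_real l) * exp (- of_real l * of_real u) + exp (- of_real l * of_real u)
        - (of_real l / (z - of_real l) * exp (- z * of_real u) + 1))" .
  have "1 + (k / (z - k) * b + b - (k / (z - k) * e + 1)) = (k * e - z * b) / (k - z)"
    if "z \<noteq> k" for k b e :: complex
  proof -
    have "z - k \<noteq> 0" "k - z \<noteq> 0" using that by auto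
    then show ?thesis by (simp add: divide_simps) (simp add: algebra_simps)
  qed
  from this[OF z(2)] show ?thesis unfolding eq .
qed

section \<open>The joint law in one transition\<close>


lemma cond_indep_given_mono:
  assumes prob: "prob_space M" and X: "X \<in> measurable M (count_space UNIV)"
    and indep: "cond_indep_given M X \<A> \<B>" and sub: "\<A>' \<subseteq> \<A>" "\<B>' \<subseteq> \<B>"
  shows "cond_indep_given M X \<A>' \<B>'"
  unfolding cond_indep_given_def
proof (intro allI impI)
  interpret prob_space M by fact
  fix i assume pos: "\<P>(\<omega> in M. X \<omega> = i) > 0"
  let ?Q = "uniform_measure M {\<omega> \<in> space M. X \<omega> = i}"
  interpret Q: prob_space ?Q
    using pos by (intro prob_space_uniform_measure) (auto simp: emeasure_eq_measure)
  have "Q.indep_set \<A> \<B>"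
    using indep pos by (simp add: cond_indep_given_def)
  then show "Q.indep_set \<A>' \<B>'"
    unfolding Q.indep_set_def by (rule Q.indep_sets_mono_sets) (use sub in \<open>auto split: bool.split\<close>)
qed

text \<open>
  One transition: \<open>V\<close> is the present workload, \<open>X\<close> and \<open>U\<close> are the present and the next state of the
  modulating chain. The time index is left out, so that the identity for the transforms is a statement about
  the five random variables of a single step.
\<close>
locale modulated_step = prob_space M
  for M :: "'w measure" +
  fixes V S A :: "'w \<Rightarrow> real" and X U :: "'w \<Rightarrow> 'n::finite"
    and P :: "real^'n^'n" and F :: "'n \<Rightarrow> real \<Rightarrow> real" and lam :: "'n \<Rightarrow> real"
  assumes V [measurable]: "V \<in> borel_measurable M"
    and S [measurable]: "S \<in> borel_measurable M"
    and A [measurable]: "A \<in> borel_measurable M"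
    and X [measurable]: "X \<in> measurable M (count_space UNIV)"
    and U [measurable]: "U \<in> measurable M (count_space UNIV)"
    and V_nonneg: "\<And>\<omega>. \<omega> \<in> space M \<Longrightarrow> 0 \<le> V \<omega>"
    and S_nonneg: "\<And>\<omega>. \<omega> \<in> space M \<Longrightarrow> 0 \<le> S \<omega>"
    and A_nonneg: "\<And>\<omega>. \<omega> \<in> space M \<Longrightarrow> 0 \<le> A \<omega>"
    and P_nonneg: "\<And>i j. 0 \<le> P $ i $ j"
    and F: "\<And>i. distribution_function_nonneg (F i)"
    and lam_pos: "\<And>j. 0 < lam j"
    and indep: "cond_indep_given M X (sets (vimage_algebra (space M) V borel))
      (sets (vimage_algebra (space M) (\<lambda>\<omega>. (A \<omega>, S \<omega>, U \<omega>))
        (borel \<Otimes>\<^sub>M (borel \<Otimes>\<^sub>M count_space UNIV))))"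
    and law: "\<And>i j x y. \<lbrakk>0 \<le> x; 0 \<le> y; \<P>(\<omega> in M. X \<omega> = i) > 0\<rbrakk> \<Longrightarrow>
      \<P>(\<omega> in M. A \<omega> \<le> x \<and> S \<omega> \<le> y \<and> U \<omega> = j \<bar> X \<omega> = i)
        = P $ i $ j * F i y * (1 - exp (- lam j * x))"
begin

abbreviation service_law :: "'n \<Rightarrow> real measure" where
  "service_law i \<equiv> interval_measure (F i)"

abbreviation interarrival_law :: "'n \<Rightarrow> real measure" where
  "interarrival_law j \<equiv> density lborel (exponential_density (lam j))"

sublocale service: prob_space "service_law i" for i
  by (rule prob_space_interval_measure[OF F])

sublocale interarrival: prob_space "interarrival_law j" for j
  by (rule prob_space_exponential_density[OF lam_pos])

sublocale SA: pair_prob_space "service_law i" "interarrival_law j" for i j ..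

lemma emeasure_interarrival_atMost:
  "emeasure (interarrival_law j) {..x} = ennreal (if 0 \<le> x then 1 - exp (- lam j * x) else 0)"
  using emeasure_erlang_density[OF lam_pos[of j], of 0 x] by (simp add: erlang_CDF_0)

text \<open>
  Multiplying the hypothesis on conditional probabilities by \<open>P(X = i)\<close> makes it valid for states of
  probability 0, and nonnegativity of both times and of the distributions extends it to all real \<open>x\<close> and \<open>y\<close>.
\<close>
lemma prob_quadrant:
  "prob {\<omega> \<in> space M. X \<omega> = i \<and> S \<omega> \<le> y \<and> A \<omega> \<le> x \<and> U \<omega> = j}
    = prob {\<omega> \<in> space M. X \<omega> = i} * P $ i $ j
      * (measure (service_law i) {..y} * measure (interarrival_law j) {..x})"
proof -
  have F_y: "measure (service_law i) {..y} = F i y"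
    using emeasure_interval_measure_atMost[OF F, of i y] F[of i]
    by (simp add: service.emeasure_eq_measure distribution_function_nonneg_def mono_def)
       (smt (verit) ennreal_inj ennreal_neg zero_le measure_nonneg)
  have G_x: "measure (interarrival_law j) {..x} = (if 0 \<le> x then 1 - exp (- lam j * x) else 0)"
    using emeasure_interarrival_atMost[of j x] lam_pos[of j]
    by (simp add: interarrival.emeasure_eq_measure split: if_splits)
  consider "prob {\<omega> \<in> space M. X \<omega> = i} = 0" | "x < 0 \<or> y < 0"
    | "0 \<le> x" "0 \<le> y" "0 < prob {\<omega> \<in> space M. X \<omega> = i}"
    using measure_nonneg[of M "{\<omega> \<in> space M. X \<omega> = i}"] by linarith
  then show ?thesis
  proof cases
    case 1
    have "prob {\<omega> \<in> space M. X \<omega> = i \<and> S \<omega> \<le> y \<and> A \<omega> \<le> x \<and> U \<omega> = j} \<le> prob {\<omega> \<in> space M. X \<omega> = i}"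
      by (intro finite_measure_mono) auto
    with 1 show ?thesis by (simp add: measure_le_0_iff)
  next
    case 2
    have "{\<omega> \<in> space M. X \<omega> = i \<and> S \<omega> \<le> y \<and> A \<omega> \<le> x \<and> U \<omega> = j} = {}"
      using 2 S_nonneg A_nonneg by force
    moreover have "F i y = 0 \<or> \<not> 0 \<le> x"
      using 2 F[of i] by (auto simp: distribution_function_nonneg_def)
    ultimately show ?thesis unfolding F_y G_x by (elim disjE) (simp_all only: measure_empty, auto)
  next
    case 3
    have "{\<omega> \<in> space M. (A \<omega> \<le> x \<and> S \<omega> \<le> y \<and> U \<omega> = j) \<and> X \<omega> = i}
        = {\<omega> \<in> space M. X \<omega> = i \<and> S \<omega> \<le> y \<and> A \<omega> \<le> x \<and> U \<omega> = j}"
      by auto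
    with law[OF 3, of j] 3 show ?thesis
      unfolding F_y G_x by (simp add: cond_prob_def field_simps)
  qed
qed

lemma emeasure_service_interarrival:
  assumes C [measurable]: "C \<in> sets (borel \<Otimes>\<^sub>M borel)"
  shows "emeasure M {\<omega> \<in> space M. X \<omega> = i \<and> (S \<omega>, A \<omega>) \<in> C \<and> U \<omega> = j}
    = ennreal (prob {\<omega> \<in> space M. X \<omega> = i} * P $ i $ j)
      * emeasure (service_law i \<Otimes>\<^sub>M interarrival_law j) C"
proof -
  let ?I = "indicator {\<omega> \<in> space M. X \<omega> = i \<and> U \<omega> = j} :: 'w \<Rightarrow> ennreal"
  define K where "K = distr (density M ?I) (borel \<Otimes>\<^sub>M borel) (\<lambda>\<omega>. (S \<omega>, A \<omega>))"
  have K: "emeasure K B = emeasure M {\<omega> \<in> space M. X \<omega> = i \<and> (S \<omega>, A \<omega>) \<in> B \<and> U \<omega> = j}"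
    if B [measurable]: "B \<in> sets (borel \<Otimes>\<^sub>M borel)" for B
  proof -
    have "emeasure K B = (\<integral>\<^sup>+ \<omega>. ?I \<omega> * indicator ((\<lambda>\<omega>. (S \<omega>, A \<omega>)) -` B \<inter> space M) \<omega> \<partial>M)"
      unfolding K_def by (simp add: emeasure_distr emeasure_density)
    also have "\<dots> = (\<integral>\<^sup>+ \<omega>. indicator {\<omega> \<in> space M. X \<omega> = i \<and> (S \<omega>, A \<omega>) \<in> B \<and> U \<omega> = j} \<omega> \<partial>M)"
      by (intro nn_integral_cong) (auto simp: indicator_def)
    finally show ?thesis by simp
  qed
  have "emeasure K C = ennreal (prob {\<omega> \<in> space M. X \<omega> = i} * P $ i $ j)
      * emeasure (service_law i \<Otimes>\<^sub>M interarrival_law j) C"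
  proof (rule emeasure_eq_pair_measure_atMost)
    show "sets K = sets borel" by (simp add: K_def borel_prod)
    show "C \<in> sets borel" using C unfolding borel_prod .
    fix y x :: real
    have "emeasure K ({..y} \<times> {..x})
        = ennreal (prob {\<omega> \<in> space M. X \<omega> = i \<and> S \<omega> \<le> y \<and> A \<omega> \<le> x \<and> U \<omega> = j})"
      by (subst K) (auto simp: emeasure_eq_measure conj_ac)
    then show "emeasure K ({..y} \<times> {..x}) = ennreal (prob {\<omega> \<in> space M. X \<omega> = i} * P $ i $ j)
        * (emeasure (service_law i) {..y} * emeasure (interarrival_law j) {..x})"
      by (simp add: prob_quadrant P_nonneg ennreal_mult
          service.emeasure_eq_measure interarrival.emeasure_eq_measure)
  qed (auto intro: service.prob_space_axioms interarrival.prob_space_axioms)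
  then show ?thesis by (simp add: K)
qed

text \<open>
  Conditional independence with the denominators cleared, which again covers states of probability 0.
\<close>
lemma prob_indep:
  assumes B [measurable]: "B \<in> sets borel" and C [measurable]: "C \<in> sets (borel \<Otimes>\<^sub>M borel)"
  shows "prob {\<omega> \<in> space M. X \<omega> = i} * prob {\<omega> \<in> space M. X \<omega> = i \<and> V \<omega> \<in> B \<and> (S \<omega>, A \<omega>) \<in> C \<and> U \<omega> = j}
    = prob {\<omega> \<in> space M. X \<omega> = i \<and> V \<omega> \<in> B} * prob {\<omega> \<in> space M. X \<omega> = i \<and> (S \<omega>, A \<omega>) \<in> C \<and> U \<omega> = j}"
proof (cases "prob {\<omega> \<in> space M. X \<omega> = i} = 0")
  case True
  have "prob {\<omega> \<in> space M. X \<omega> = i \<and> V \<omega> \<in> B} \<le> prob {\<omega> \<in> space M. X \<omega> = i}"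
    by (intro finite_measure_mono) auto
  with True show ?thesis by (simp add: measure_le_0_iff)
next
  case False
  let ?X = "{\<omega> \<in> space M. X \<omega> = i}"
  let ?Q = "uniform_measure M ?X"
  have pos: "0 < prob ?X" using False by (simp add: zero_less_measure_iff)
  interpret Q: prob_space ?Q
    using pos by (intro prob_space_uniform_measure) (auto simp: emeasure_eq_measure)
  have measure_Q: "measure ?Q D = prob (?X \<inter> D) / prob ?X" if "D \<in> events" for D
    using that pos by (intro measure_uniform_measure) (auto simp: emeasure_eq_measure)
  let ?D = "{\<omega> \<in> space M. V \<omega> \<in> B}"
  let ?E = "{\<omega> \<in> space M. (S \<omega>, A \<omega>) \<in> C \<and> U \<omega> = j}"
  have "?D \<in> sets (vimage_algebra (space M) V borel)"
    by (subst sets_vimage_algebra2) (auto intro!: exI[of _ B])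
  moreover have "?E \<in> sets (vimage_algebra (space M) (\<lambda>\<omega>. (A \<omega>, S \<omega>, U \<omega>))
        (borel \<Otimes>\<^sub>M (borel \<Otimes>\<^sub>M count_space UNIV)))"
  proof -
    have "{t \<in> space (borel \<Otimes>\<^sub>M (borel \<Otimes>\<^sub>M count_space UNIV)). (fst (snd t), fst t) \<in> C \<and> snd (snd t) = j}
        \<in> sets (borel \<Otimes>\<^sub>M (borel \<Otimes>\<^sub>M count_space (UNIV :: 'n set)))"
      by measurable
    moreover have "?E = (\<lambda>\<omega>. (A \<omega>, S \<omega>, U \<omega>)) -` {t \<in> space (borel \<Otimes>\<^sub>M (borel \<Otimes>\<^sub>M count_space UNIV)).
        (fst (snd t), fst t) \<in> C \<and> snd (snd t) = j} \<inter> space M"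
      by (auto simp: space_pair_measure)
    ultimately show ?thesis
      by (metis (no_types, lifting) in_vimage_algebra)
  qed
  moreover have "Q.indep_set (sets (vimage_algebra (space M) V borel))
      (sets (vimage_algebra (space M) (\<lambda>\<omega>. (A \<omega>, S \<omega>, U \<omega>))
        (borel \<Otimes>\<^sub>M (borel \<Otimes>\<^sub>M count_space UNIV))))"
    using indep pos by (simp add: cond_indep_given_def)
  ultimately have "measure ?Q (?D \<inter> ?E) = measure ?Q ?D * measure ?Q ?E"
    by (rule Q.indep_setD[rotated])
  also have "measure ?Q (?D \<inter> ?E) = prob (?X \<inter> (?D \<inter> ?E)) / prob ?X" by (intro measure_Q) measurable
  also have "measure ?Q ?D = prob (?X \<inter> ?D) / prob ?X" by (intro measure_Q) measurable
  also have "measure ?Q ?E = prob (?X \<inter> ?E) / prob ?X" by (intro measure_Q) measurable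
  also have "?X \<inter> (?D \<inter> ?E) = {\<omega> \<in> space M. X \<omega> = i \<and> V \<omega> \<in> B \<and> (S \<omega>, A \<omega>) \<in> C \<and> U \<omega> = j}" by auto
  also have "?X \<inter> ?D = {\<omega> \<in> space M. X \<omega> = i \<and> V \<omega> \<in> B}" by auto
  also have "?X \<inter> ?E = {\<omega> \<in> space M. X \<omega> = i \<and> (S \<omega>, A \<omega>) \<in> C \<and> U \<omega> = j}" by auto
  finally show ?thesis using pos by (simp add: field_simps)
qed

lemma emeasure_joint:
  assumes B [measurable]: "B \<in> sets borel" and C [measurable]: "C \<in> sets (borel \<Otimes>\<^sub>M borel)"
  shows "emeasure M {\<omega> \<in> space M. X \<omega> = i \<and> V \<omega> \<in> B \<and> (S \<omega>, A \<omega>) \<in> C \<and> U \<omega> = j}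
    = ennreal (P $ i $ j) * emeasure M {\<omega> \<in> space M. X \<omega> = i \<and> V \<omega> \<in> B}
      * emeasure (service_law i \<Otimes>\<^sub>M interarrival_law j) C"
proof -
  let ?q = "prob {\<omega> \<in> space M. X \<omega> = i}"
  let ?VB = "{\<omega> \<in> space M. X \<omega> = i \<and> V \<omega> \<in> B}"
  let ?all = "{\<omega> \<in> space M. X \<omega> = i \<and> V \<omega> \<in> B \<and> (S \<omega>, A \<omega>) \<in> C \<and> U \<omega> = j}"
  have real_law: "prob {\<omega> \<in> space M. X \<omega> = i \<and> (S \<omega>, A \<omega>) \<in> C \<and> U \<omega> = j}
      = ?q * P $ i $ j * measure (service_law i \<Otimes>\<^sub>M interarrival_law j) C"
    using emeasure_service_interarrival[OF C, of i j] P_nonneg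
    by (simp add: emeasure_eq_measure SA.emeasure_eq_measure ennreal_mult[symmetric])
  have le: "prob ?all \<le> ?q" "prob ?VB \<le> ?q"
    by (intro finite_measure_mono; auto)+
  have "prob ?all = P $ i $ j * prob ?VB * measure (service_law i \<Otimes>\<^sub>M interarrival_law j) C"
  proof (cases "?q = 0")
    case True
    then show ?thesis using le by (simp add: measure_le_0_iff)
  next
    case False
    have "?q * prob ?all = ?q * (P $ i $ j * prob ?VB * measure (service_law i \<Otimes>\<^sub>M interarrival_law j) C)"
      unfolding prob_indep[OF B C, of i j] real_law by (simp add: mult_ac)
    then show ?thesis using False by simp
  qed
  then show ?thesis
    using P_nonneg by (simp add: emeasure_eq_measure SA.emeasure_eq_measure ennreal_mult)
qed

text \<open>
  The law of \<open>V\<close> on \<open>X = i\<close>, with the transition probability \<open>P $ i $ j\<close> built in as a weight. With this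
  convention the joint law below is exactly a product and the other two factors stay probability measures.
\<close>
abbreviation workload_law :: "'n \<Rightarrow> 'n \<Rightarrow> real measure" where
  "workload_law i j \<equiv>
     distr (density M (\<lambda>\<omega>. ennreal (P $ i $ j * indicator {\<omega> \<in> space M. X \<omega> = i} \<omega>))) borel V"

lemma finite_workload_law: "finite_measure (workload_law i j)"
proof (intro finite_measure.finite_measure_distr finite_measureI)
  have "emeasure (density M (\<lambda>\<omega>. ennreal (P $ i $ j * indicator {\<omega> \<in> space M. X \<omega> = i} \<omega>))) (space M)
      \<le> (\<integral>\<^sup>+ \<omega>. ennreal (P $ i $ j) \<partial>M)"
    by (subst emeasure_density) (auto intro!: nn_integral_mono simp del: nn_integral_const simp: P_nonneg indicator_def)
  also have "\<dots> < \<infinity>" by (simp add: emeasure_space_1)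
  finally show "emeasure (density M (\<lambda>\<omega>. ennreal (P $ i $ j * indicator {\<omega> \<in> space M. X \<omega> = i} \<omega>)))
      (space (density M (\<lambda>\<omega>. ennreal (P $ i $ j * indicator {\<omega> \<in> space M. X \<omega> = i} \<omega>)))) \<noteq> \<infinity>"
    by simp
qed simp

text \<open>
  This turns the hypotheses on the triple into a form to which Fubini's theorem applies: on the event
  \<open>X = i\<close>, \<open>U = j\<close> the present workload, the service time and the interarrival time are independent.
\<close>
lemma distr_joint:
  "workload_law i j \<Otimes>\<^sub>M (service_law i \<Otimes>\<^sub>M interarrival_law j)
    = distr (density M (indicator {\<omega> \<in> space M. X \<omega> = i \<and> U \<omega> = j}))
        (borel \<Otimes>\<^sub>M (borel \<Otimes>\<^sub>M borel)) (\<lambda>\<omega>. (V \<omega>, S \<omega>, A \<omega>))"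
proof (rule pair_measure_eqI)
  interpret V: finite_measure "workload_law i j" by (rule finite_workload_law)
  show "sigma_finite_measure (workload_law i j)" ..
  show "sigma_finite_measure (service_law i \<Otimes>\<^sub>M interarrival_law j)" ..
  have sets_SA: "sets (service_law i \<Otimes>\<^sub>M interarrival_law j) = sets (borel \<Otimes>\<^sub>M borel)"
    by (intro sets_pair_measure_cong) auto
  then show "sets (workload_law i j \<Otimes>\<^sub>M (service_law i \<Otimes>\<^sub>M interarrival_law j))
      = sets (distr (density M (indicator {\<omega> \<in> space M. X \<omega> = i \<and> U \<omega> = j}))
          (borel \<Otimes>\<^sub>M (borel \<Otimes>\<^sub>M borel)) (\<lambda>\<omega>. (V \<omega>, S \<omega>, A \<omega>)))"
    unfolding sets_distr by (intro sets_pair_measure_cong) auto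
  fix B C assume "B \<in> sets (workload_law i j)" "C \<in> sets (service_law i \<Otimes>\<^sub>M interarrival_law j)"
  then have B [measurable]: "B \<in> sets borel" and C [measurable]: "C \<in> sets (borel \<Otimes>\<^sub>M borel)"
    by (auto simp: sets_SA)
  have "emeasure (workload_law i j) B
      = (\<integral>\<^sup>+ \<omega>. ennreal (P $ i $ j * indicator {\<omega> \<in> space M. X \<omega> = i} \<omega>) * indicator (V -` B \<inter> space M) \<omega> \<partial>M)"
    by (simp add: emeasure_distr emeasure_density)
  also have "\<dots> = (\<integral>\<^sup>+ \<omega>. ennreal (P $ i $ j) * indicator {\<omega> \<in> space M. X \<omega> = i \<and> V \<omega> \<in> B} \<omega> \<partial>M)"
    by (intro nn_integral_cong) (auto simp: indicator_def)
  also have "\<dots> = ennreal (P $ i $ j) * emeasure M {\<omega> \<in> space M. X \<omega> = i \<and> V \<omega> \<in> B}"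
    by (subst nn_integral_cmult_indicator) auto
  finally have B_eq: "emeasure (workload_law i j) B = \<dots>" .
  have "emeasure (distr (density M (indicator {\<omega> \<in> space M. X \<omega> = i \<and> U \<omega> = j}))
      (borel \<Otimes>\<^sub>M (borel \<Otimes>\<^sub>M borel)) (\<lambda>\<omega>. (V \<omega>, S \<omega>, A \<omega>))) (B \<times> C)
      = (\<integral>\<^sup>+ \<omega>. indicator {\<omega> \<in> space M. X \<omega> = i \<and> U \<omega> = j} \<omega>
          * indicator ((\<lambda>\<omega>. (V \<omega>, S \<omega>, A \<omega>)) -` (B \<times> C) \<inter> space M) \<omega> \<partial>M)"
    by (simp add: emeasure_distr emeasure_density)
  also have "\<dots> = (\<integral>\<^sup>+ \<omega>. indicator {\<omega> \<in> space M. X \<omega> = i \<and> V \<omega> \<in> B \<and> (S \<omega>, A \<omega>) \<in> C \<and> U \<omega> = j} \<omega> \<partial>M)"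
    by (intro nn_integral_cong) (auto simp: indicator_def)
  also have "\<dots> = emeasure M {\<omega> \<in> space M. X \<omega> = i \<and> V \<omega> \<in> B \<and> (S \<omega>, A \<omega>) \<in> C \<and> U \<omega> = j}"
    by (rule nn_integral_indicator) measurable
  finally show "emeasure (workload_law i j) B * emeasure (service_law i \<Otimes>\<^sub>M interarrival_law j) C
      = emeasure (distr (density M (indicator {\<omega> \<in> space M. X \<omega> = i \<and> U \<omega> = j}))
      (borel \<Otimes>\<^sub>M (borel \<Otimes>\<^sub>M borel)) (\<lambda>\<omega>. (V \<omega>, S \<omega>, A \<omega>))) (B \<times> C)"
    unfolding B_eq emeasure_joint[OF B C] by simp
qed

section \<open>The one-step identity for transforms\<close>


lemma integral_workload_law:
  assumes [measurable]: "f \<in> borel_measurable borel"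
  shows "(LINT v|workload_law i j. f v)
    = complex_of_real (P $ i $ j) * (LINT \<omega>|M. f (V \<omega>) * indicator {\<omega>. X \<omega> = i} \<omega>)"
proof -
  have "(LINT v|workload_law i j. f v)
      = (LINT \<omega>|M. (P $ i $ j * indicator {\<omega> \<in> space M. X \<omega> = i} \<omega>) *\<^sub>R f (V \<omega>))"
    using P_nonneg by (simp add: integral_distr integral_density)
  also have "\<dots> = (LINT \<omega>|M. complex_of_real (P $ i $ j) * (f (V \<omega>) * indicator {\<omega>. X \<omega> = i} \<omega>))"
    by (intro Bochner_Integration.integral_cong) (auto simp: indicator_def scaleR_conv_of_real)
  finally show ?thesis by simp
qed

text \<open>
  The contribution of a transition from \<open>i\<close> to \<open>j\<close>. After Fubini's theorem the innermost integral, over the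
  interarrival time, is \<open>integral_exponential_reflected\<close>; what remains is a difference of two products of a
  function of the workload and a function of the service time.
\<close>
lemma integral_one_transition:
  fixes z :: complex and \<alpha> :: real
  assumes \<alpha>: "0 \<le> \<alpha>" and z: "0 \<le> Re z" "z \<noteq> complex_of_real (lam j)"
  shows "(LINT \<omega>|M. indicator {\<omega> \<in> space M. X \<omega> = i \<and> U \<omega> = j} \<omega>
      *\<^sub>R exp (- z * complex_of_real (max 0 (\<alpha> * V \<omega> + S \<omega> - A \<omega>))))
    = complex_of_real (P $ i $ j) / (of_real (lam j) - z) *
      (of_real (lam j) * LS_transform (F i) z * joint_transform M V X i (of_real \<alpha> * z)
       - z * LS_transform (F i) (of_real (lam j)) * joint_transform M V X i (of_real \<alpha> * of_real (lam j)))"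
proof -
  let ?VL = "workload_law i j" and ?SL = "service_law i" and ?AL = "interarrival_law j"
  let ?l = "complex_of_real (lam j)"
  interpret VL: finite_measure ?VL by (rule finite_workload_law)
  interpret VSA: pair_sigma_finite ?VL "?SL \<Otimes>\<^sub>M ?AL" ..
  interpret V3: finite_measure "?VL \<Otimes>\<^sub>M (?SL \<Otimes>\<^sub>M ?AL)"
    by (intro finite_measure_pair_measure finite_workload_law
        service.finite_measure_axioms interarrival.finite_measure_axioms)
  define f :: "real \<times> real \<times> real \<Rightarrow> complex" where
    "f = (\<lambda>(v, s, x). exp (- z * of_real (max 0 (\<alpha> * v + s - x))))"
  have f [measurable]: "f \<in> borel_measurable (borel \<Otimes>\<^sub>M (borel \<Otimes>\<^sub>M borel))"
    unfolding f_def by measurable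
  have norm_f: "norm (f t) \<le> 1" for t
    using z by (auto simp: f_def norm_exp_eq_Re split_beta)
  let ?c = "\<lambda>w v. exp (- (of_real \<alpha> * w) * complex_of_real v)"
  let ?b = "\<lambda>w s. exp (- w * complex_of_real s)"
  have b_int: "integrable ?SL (?b w)" if "0 \<le> Re w" for w
    using AE_interval_measure_nonneg[OF F[of i]] that
    by (intro service.integrable_const_bound[where B=1]) (auto simp: norm_exp_eq_Re elim!: eventually_mono)
  \<comment> \<open>Under the laws of workload and service time, nonnegativity holds only almost everywhere. It bounds
    the exponentials by 1 and gives the condition \<open>0 \<le> u\<close> of \<open>integral_exponential_reflected\<close>.\<close>
  have V_int_nonneg: "AE v in ?VL. 0 \<le> v"
    by (subst AE_distr_iff) (auto simp: AE_density V_nonneg)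
  have c_int: "integrable ?VL (?c w)" if "0 \<le> Re w" for w
    using V_int_nonneg that \<alpha>
    by (intro VL.integrable_const_bound[where B=1]) (auto simp: norm_exp_eq_Re elim!: eventually_mono)
  have LS: "(LINT s|?SL. ?b w s) = LS_transform (F i) w" for w
    by (rule LS_transform_eq_integral[OF F, symmetric])
  have c_eq: "(LINT v|?VL. ?c w v)
      = complex_of_real (P $ i $ j) * joint_transform M V X i (of_real \<alpha> * w)" for w
    unfolding joint_transform_def by (rule integral_workload_law) measurable
  have exp_split: "exp (- w * complex_of_real (\<alpha> * v + s)) = ?c w v * ?b w s" for w v s
    unfolding mult_exp_exp by (simp add: algebra_simps)
  have l: "0 \<le> Re ?l" using lam_pos[of j] by simp
  have "(LINT \<omega>|M. indicator {\<omega> \<in> space M. X \<omega> = i \<and> U \<omega> = j} \<omega>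
      *\<^sub>R exp (- z * complex_of_real (max 0 (\<alpha> * V \<omega> + S \<omega> - A \<omega>))))
    = (LINT \<omega>|density M (\<lambda>\<omega>. ennreal (indicator {\<omega> \<in> space M. X \<omega> = i \<and> U \<omega> = j} \<omega>)). f (V \<omega>, S \<omega>, A \<omega>))"
    by (subst integral_density) (auto simp: f_def)
  also have "\<dots> = (LINT t|distr (density M (indicator {\<omega> \<in> space M. X \<omega> = i \<and> U \<omega> = j}))
        (borel \<Otimes>\<^sub>M (borel \<Otimes>\<^sub>M borel)) (\<lambda>\<omega>. (V \<omega>, S \<omega>, A \<omega>)). f t)"
    by (subst integral_distr) (auto simp: ennreal_indicator)
  also have "\<dots> = (LINT t|(?VL \<Otimes>\<^sub>M (?SL \<Otimes>\<^sub>M ?AL)). f t)"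
    unfolding distr_joint ..
  also have "\<dots> = (LINT v|?VL. (LINT t|(?SL \<Otimes>\<^sub>M ?AL). f (v, t)))"
    using norm_f f
    by (intro VSA.integral_fst'[symmetric] V3.integrable_const_bound[where B=1])
       (auto simp: measurable_def space_pair_measure cong: sets_pair_measure_cong)
  also have "\<dots> = (LINT v|?VL. (LINT s|?SL. (LINT x|?AL. f (v, s, x))))"
    using norm_f
    by (intro Bochner_Integration.integral_cong refl SA.integral_fst'[symmetric] SA.integrable_const_bound[where B=1])
       (auto intro!: measurable_compose[OF _ f])
  also have "\<dots> = (LINT v|?VL. (?l * ?c z v * LS_transform (F i) z - z * ?c ?l v * LS_transform (F i) ?l) / (?l - z))"
  proof (intro integral_cong_AE)
    show "AE v in ?VL. (LINT s|?SL. (LINT x|?AL. f (v, s, x)))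
        = (?l * ?c z v * LS_transform (F i) z - z * ?c ?l v * LS_transform (F i) ?l) / (?l - z)"
      using V_int_nonneg
    proof eventually_elim
      case (elim v)
      have "(LINT s|?SL. (LINT x|?AL. f (v, s, x)))
          = (LINT s|?SL. (?l * ?c z v * ?b z s - z * ?c ?l v * ?b ?l s) / (?l - z))"
      proof (intro integral_cong_AE)
        show "AE s in ?SL. (LINT x|?AL. f (v, s, x))
            = (?l * ?c z v * ?b z s - z * ?c ?l v * ?b ?l s) / (?l - z)"
          using AE_interval_measure_nonneg[OF F[of i]]
        proof eventually_elim
          case (elim s)
          have u: "0 \<le> \<alpha> * v + s" using elim \<open>0 \<le> v\<close> \<alpha> by simp
          show ?case
            using integral_exponential_reflected[OF lam_pos u z]
            unfolding f_def exp_split by (simp add: mult.assoc)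
        qed
      qed (simp_all add: f_def, measurable)
      also have "\<dots> = (?l * ?c z v * LS_transform (F i) z - z * ?c ?l v * LS_transform (F i) ?l) / (?l - z)"
        using b_int[OF z(1)] b_int[OF l] by (simp add: LS[symmetric])
      finally show ?case .
    qed
  qed (simp_all add: f_def, measurable)
  also have "\<dots> = (?l * (LINT v|?VL. ?c z v) * LS_transform (F i) z
      - z * (LINT v|?VL. ?c ?l v) * LS_transform (F i) ?l) / (?l - z)"
    using c_int[OF z(1)] c_int[OF l] by simp
  finally show ?thesis unfolding c_eq by (simp add: field_simps)
qed

lemma joint_transform_step:
  fixes z :: complex and \<alpha> :: real
  assumes \<alpha>: "0 \<le> \<alpha>" and z: "0 \<le> Re z" "z \<noteq> complex_of_real (lam j)"
  shows "joint_transform M (\<lambda>\<omega>. max 0 (\<alpha> * V \<omega> + S \<omega> - A \<omega>)) U j z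
    = of_real (lam j) / (of_real (lam j) - z) *
        (\<Sum>i\<in>UNIV. complex_of_real (P $ i $ j) * LS_transform (F i) z * joint_transform M V X i (of_real \<alpha> * z))
      - z / (of_real (lam j) - z) *
        (\<Sum>i\<in>UNIV. complex_of_real (P $ i $ j) * LS_transform (F i) (of_real (lam j))
          * joint_transform M V X i (of_real \<alpha> * of_real (lam j)))"
proof -
  let ?h = "\<lambda>\<omega>. exp (- z * complex_of_real (max 0 (\<alpha> * V \<omega> + S \<omega> - A \<omega>)))"
  have "joint_transform M (\<lambda>\<omega>. max 0 (\<alpha> * V \<omega> + S \<omega> - A \<omega>)) U j z
      = (LINT \<omega>|M. (\<Sum>i\<in>UNIV. indicator {\<omega> \<in> space M. X \<omega> = i \<and> U \<omega> = j} \<omega> *\<^sub>R ?h \<omega>))"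
    unfolding joint_transform_def
  proof (intro Bochner_Integration.integral_cong refl)
    fix \<omega> assume \<omega>: "\<omega> \<in> space M"
    have "(\<Sum>i\<in>UNIV. indicator {\<omega> \<in> space M. X \<omega> = i \<and> U \<omega> = j} \<omega> *\<^sub>R ?h \<omega>)
        = (\<Sum>i\<in>UNIV. if i = X \<omega> then indicator {\<omega>. U \<omega> = j} \<omega> *\<^sub>R ?h \<omega> else 0)"
      using \<omega> by (intro sum.cong) (auto simp: indicator_def)
    then show "?h \<omega> * indicator {\<omega>. U \<omega> = j} \<omega>
        = (\<Sum>i\<in>UNIV. indicator {\<omega> \<in> space M. X \<omega> = i \<and> U \<omega> = j} \<omega> *\<^sub>R ?h \<omega>)"
      by (simp add: indicator_def)
  qed
  also have "\<dots> = (\<Sum>i\<in>UNIV. (LINT \<omega>|M. indicator {\<omega> \<in> space M. X \<omega> = i \<and> U \<omega> = j} \<omega> *\<^sub>R ?h \<omega>))"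
    using z by (intro Bochner_Integration.integral_sum integrable_const_bound[where B=1])
      (auto simp: norm_exp_eq_Re indicator_def)
  also have "\<dots> = (\<Sum>i\<in>UNIV. of_real (lam j) / (of_real (lam j) - z) *
        (complex_of_real (P $ i $ j) * LS_transform (F i) z * joint_transform M V X i (of_real \<alpha> * z))
      - z / (of_real (lam j) - z) *
        (complex_of_real (P $ i $ j) * LS_transform (F i) (of_real (lam j))
          * joint_transform M V X i (of_real \<alpha> * of_real (lam j))))"
  proof (intro sum.cong refl)
    show "(LINT \<omega>|M. indicator {\<omega> \<in> space M. X \<omega> = i \<and> U \<omega> = j} \<omega> *\<^sub>R ?h \<omega>)
      = of_real (lam j) / (of_real (lam j) - z) *
        (complex_of_real (P $ i $ j) * LS_transform (F i) z * joint_transform M V X i (of_real \<alpha> * z))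
      - z / (of_real (lam j) - z) *
        (complex_of_real (P $ i $ j) * LS_transform (F i) (of_real (lam j))
          * joint_transform M V X i (of_real \<alpha> * of_real (lam j)))" for i
      unfolding integral_one_transition[OF \<alpha> z] by (simp add: divide_inverse algebra_simps)
  qed
  finally show ?thesis by (simp add: sum_subtractf sum_distrib_left)
qed

end

section \<open>Componentwise action of the coefficient matrices\<close>


lemma diag_mat_mult_vec: "(diag_mat d *v x) $ i = d i * x $ i" for d :: "'n::finite \<Rightarrow> 'a::semiring_1"
  by (simp add: diag_mat_def matrix_vector_mult_def if_distrib[of "\<lambda>y. y * _"] cong: if_cong)

lemma diag_mat_mult: "diag_mat c ** diag_mat d = diag_mat (\<lambda>i. c i * d i)" for c d :: "'n::finite \<Rightarrow> 'a::semiring_1"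
  by (simp add: diag_mat_def matrix_matrix_mult_def vec_eq_iff if_distrib[of "\<lambda>y. y * _"] cong: if_cong)

lemma matrix_inv_diag_mat:
  fixes d :: "'n::finite \<Rightarrow> 'a::field"
  assumes "\<And>i. d i \<noteq> 0"
  shows "matrix_inv (diag_mat d) = diag_mat (\<lambda>i. inverse (d i))"
proof -
  let ?D = "diag_mat d" and ?E = "diag_mat (\<lambda>i. inverse (d i))"
  have one: "diag_mat (\<lambda>i. 1) = (mat 1 :: 'a^'n^'n)" by (simp add: diag_mat_def mat_def)
  have E: "?D ** ?E = mat 1" "?E ** ?D = mat 1"
    using assms by (simp_all add: diag_mat_mult one)
  then have "?D ** matrix_inv ?D = mat 1 \<and> matrix_inv ?D ** ?D = mat 1"
    unfolding matrix_inv_def by (intro someI[of "\<lambda>B. ?D ** B = mat 1 \<and> B ** ?D = mat 1"]) simp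
  then show ?thesis
    by (metis E(2) matrix_mul_assoc matrix_mul_lid matrix_mul_rid)
qed

lemma H_mat_mult_vec:
  "(H_mat P FS lam s *v x) $ j = complex_of_real (lam j) / (complex_of_real (lam j) - s)
    * (\<Sum>i\<in>UNIV. complex_of_real (P $ i $ j) * LS_transform (FS i) s * x $ i)"
proof -
  have "H_mat P FS lam s *v x
      = L_mat lam s *v (transpose (map_matrix complex_of_real P) *v (B_mat FS s *v x))"
    by (simp add: H_mat_def matrix_vector_mul_assoc[symmetric])
  moreover have "(transpose (map_matrix complex_of_real P) *v y) $ j
      = (\<Sum>i\<in>UNIV. complex_of_real (P $ i $ j) * y $ i)" for y
    by (simp add: matrix_vector_mult_def transpose_def map_matrix_def)
  ultimately show ?thesis
    by (simp add: L_mat_def B_mat_def diag_mat_mult_vec mult.assoc)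
qed

lemma F_mat_mult_vec:
  assumes "\<And>j. 0 < lam j"
  shows "(s *s (F_mat lam s *v x)) $ j = - (s / (complex_of_real (lam j) - s) * x $ j)"
proof -
  have ne: "complex_of_real (lam j) \<noteq> 0" for j using assms[of j] by simp
  have uminus: "(- B *v x) = - (B *v x)" for B :: "complex^'a^'a"
    by (simp add: matrix_vector_mult_def vec_eq_iff sum_negf)
  show ?thesis
    using ne[of j]
    by (simp add: F_mat_def Lambda_mat_def L_mat_def matrix_inv_diag_mat[OF ne] diag_mat_mult
        uminus diag_mat_mult_vec field_simps)
qed

section \<open>The functional equation of the steady-state transforms\<close>


theorem theorem1:
  fixes M :: "'w measure" and M' :: "'v measure"
    and W A S :: "nat \<Rightarrow> 'w \<Rightarrow> real" and Y :: "nat \<Rightarrow> 'w \<Rightarrow> 'n::finite"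
    and P :: "real^'n^'n" and \<pi> :: "real^'n"
    and FS :: "'n \<Rightarrow> real \<Rightarrow> real" and lam :: "'n \<Rightarrow> real" and a :: real
    and W_inf :: "'v \<Rightarrow> real" and Y_inf :: "'v \<Rightarrow> 'n"
  assumes "prob_space M"
    and "0 < a" and "a < 1"
    and "markov_chain M Y P"
    and "irreducible_matrix P"
    and "stationary_distribution P \<pi>"
    and "\<And>n. W n \<in> borel_measurable M"
    and "\<And>n. A (Suc n) \<in> borel_measurable M"
    and "\<And>n. S n \<in> borel_measurable M"
    and "\<And>n \<omega>. \<omega> \<in> space M \<Longrightarrow> 0 \<le> W n \<omega>"
    and "\<And>n \<omega>. \<omega> \<in> space M \<Longrightarrow> 0 \<le> A (Suc n) \<omega>"
    and "\<And>n \<omega>. \<omega> \<in> space M \<Longrightarrow> 0 \<le> S n \<omega>"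
    and "\<And>n \<omega>. \<omega> \<in> space M \<Longrightarrow> W (Suc n) \<omega> = max 0 (a * W n \<omega> + S n \<omega> - A (Suc n) \<omega>)"
    and "\<And>i. distribution_function_nonneg (FS i)"
    and "\<And>j. 0 < lam j"
    and "\<And>n. cond_indep_given M (Y n) (past M W A S Y n) (current_triple M A S Y n)"
    and "\<And>n i j x y. \<lbrakk>0 \<le> x; 0 \<le> y; \<P>(\<omega> in M. Y n \<omega> = i) > 0\<rbrakk> \<Longrightarrow>
           \<P>(\<omega> in M. A (Suc n) \<omega> \<le> x \<and> S n \<omega> \<le> y \<and> Y (Suc n) \<omega> = j \<bar> Y n \<omega> = i)
             = P $ i $ j * FS i y * (1 - exp (- lam j * x))"
    and "prob_space M'"
    and "W_inf \<in> borel_measurable M'"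
    and "Y_inf \<in> measurable M' (count_space UNIV)"
    and "\<And>\<omega>. \<omega> \<in> space M' \<Longrightarrow> 0 \<le> W_inf \<omega>"
    and "\<And>i. \<P>(\<omega> in M'. Y_inf \<omega> = i) = \<pi> $ i"
    and "\<And>i s. 0 \<le> Re s \<Longrightarrow>
           (\<lambda>n. joint_transform M (W n) (Y n) i s) \<longlonglongrightarrow> joint_transform M' W_inf Y_inf i s"
  shows "\<forall>s. 0 \<le> Re s \<and> s \<notin> range (\<lambda>j. complex_of_real (lam j)) \<longrightarrow>
           (\<forall>j. Z_lim M W Y j s =
              complex_of_real (lam j) / (complex_of_real (lam j) - s) *
                (\<Sum>i\<in>UNIV. complex_of_real (P $ i $ j) * LS_transform (FS i) s *
                   Z_lim M W Y i (complex_of_real a * s))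
              - s / (complex_of_real (lam j) - s) * v_vec M W Y P FS lam a $ j) \<and>
           Z_vec M W Y s = H_mat P FS lam s *v Z_vec M W Y (complex_of_real a * s)
              + V_vec M W Y P FS lam a s"
proof (intro allI impI)
  fix s assume s: "0 \<le> Re s \<and> s \<notin> range (\<lambda>j. complex_of_real (lam j))"
  let ?J = "\<lambda>n i z. joint_transform M (W n) (Y n) i z"
  interpret prob_space M by fact
  have Y: "\<And>n. Y n \<in> measurable M (count_space UNIV)"
    and P_nonneg: "\<And>i j. 0 \<le> P $ i $ j"
    using assms(4) by (auto simp: markov_chain_def stochastic_matrix_def)
  have step: "modulated_step M (W n) (S n) (A (Suc n)) (Y n) (Y (Suc n)) P FS lam" for n
  proof
    have "sets (vimage_algebra (space M) (W n) borel) \<subseteq> past M W A S Y n"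
    proof
      fix D assume "D \<in> sets (vimage_algebra (space M) (W n) borel)"
      then obtain B where "B \<in> sets borel" "D = W n -` B \<inter> space M"
        by (auto simp: sets_vimage_algebra2)
      then show "D \<in> past M W A S Y n"
        unfolding past_def by (intro sigma_sets.Basic UnI1) blast
    qed
    then show "cond_indep_given M (Y n) (sets (vimage_algebra (space M) (W n) borel))
      (sets (vimage_algebra (space M) (\<lambda>\<omega>. (A (Suc n) \<omega>, S n \<omega>, Y (Suc n) \<omega>))
        (borel \<Otimes>\<^sub>M (borel \<Otimes>\<^sub>M count_space UNIV))))"
      using cond_indep_given_mono[OF assms(1) Y assms(16)[of n]] by (simp add: current_triple_def)
  qed (fact assms Y P_nonneg)+
  have J_Suc: "?J (Suc n) j s = of_real (lam j) / (of_real (lam j) - s) *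
        (\<Sum>i\<in>UNIV. complex_of_real (P $ i $ j) * LS_transform (FS i) s * ?J n i (of_real a * s))
      - s / (of_real (lam j) - s) *
        (\<Sum>i\<in>UNIV. complex_of_real (P $ i $ j) * LS_transform (FS i) (of_real (lam j))
          * ?J n i (of_real a * of_real (lam j)))" for n j
  proof -
    have "?J (Suc n) j s
        = joint_transform M (\<lambda>\<omega>. max 0 (a * W n \<omega> + S n \<omega> - A (Suc n) \<omega>)) (Y (Suc n)) j s"
      unfolding joint_transform_def
      by (intro Bochner_Integration.integral_cong refl) (simp add: assms(13))
    then show ?thesis
      using modulated_step.joint_transform_step[OF step, of a s j n] s assms(2) by auto
  qed
  have J_lim: "(\<lambda>n. ?J n i z) \<longlonglongrightarrow> Z_lim M W Y i z" if "0 \<le> Re z" for i z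
    using assms(23)[OF that, of i] unfolding Z_lim_def by (simp add: limI)
  have Z: "Z_lim M W Y j s = of_real (lam j) / (of_real (lam j) - s) *
        (\<Sum>i\<in>UNIV. complex_of_real (P $ i $ j) * LS_transform (FS i) s * Z_lim M W Y i (of_real a * s))
      - s / (of_real (lam j) - s) * v_vec M W Y P FS lam a $ j" for j
  proof (rule LIMSEQ_unique)
    show "(\<lambda>n. ?J (Suc n) j s) \<longlonglongrightarrow> Z_lim M W Y j s"
      using s by (intro LIMSEQ_Suc J_lim) simp
    show "(\<lambda>n. ?J (Suc n) j s) \<longlonglongrightarrow> of_real (lam j) / (of_real (lam j) - s) *
        (\<Sum>i\<in>UNIV. complex_of_real (P $ i $ j) * LS_transform (FS i) s * Z_lim M W Y i (of_real a * s))
      - s / (of_real (lam j) - s) * v_vec M W Y P FS lam a $ j"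
      unfolding J_Suc v_vec_def vec_lambda_beta
      using s assms(2) assms(15)[of j] by (intro tendsto_intros J_lim) auto
  qed
  have "Z_vec M W Y s = H_mat P FS lam s *v Z_vec M W Y (complex_of_real a * s)
      + V_vec M W Y P FS lam a s"
    unfolding vec_eq_iff V_vec_def
    using Z by (simp only: vector_add_component H_mat_mult_vec F_mat_mult_vec[OF assms(15)]
        Z_vec_def vec_lambda_beta diff_conv_add_uminus) simp
  with Z show "(\<forall>j. Z_lim M W Y j s =
              complex_of_real (lam j) / (complex_of_real (lam j) - s) *
                (\<Sum>i\<in>UNIV. complex_of_real (P $ i $ j) * LS_transform (FS i) s *
                   Z_lim M W Y i (complex_of_real a * s))
              - s / (complex_of_real (lam j) - s) * v_vec M W Y P FS lam a $ j) \<and>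
           Z_vec M W Y s = H_mat P FS lam s *v Z_vec M W Y (complex_of_real a * s)
              + V_vec M W Y P FS lam a s"
    by blast
qed

end
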